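(* Let $\sigma,\tau\subseteq\mathbb{R}^n$ be two root cones (possibly linear subspaces). Then $\sigma\cap\tau$ is a root cone if and only if the intersection graph $\Gamma_{\sigma,\tau}$ does not have a primitive alternating cycle of length at least four.
   Context: Roots are $e_{ij}=e_i-e_j$ ($i\ne j$). A root cone is a (not necessarily pointed) cone generated by finitely many roots under nonnegative linear combinations. For a root cone $\sigma$, $\Gamma_\sigma$ is the partially directed graph on $[n]$ with an undirected edge $\{i,j\}$ if both $e_{ij},e_{ji}\in\sigma$, and a directed edge $i\to j$ if $e_{ij}\in\sigma$ and $e_{ji}\notin\sigma$. $\Gamma_\tau^{\mathrm{op}}$ is $\Gamma_\tau$ with all directed edges reversed. The intersection graph $\Gamma_{\sigma,\tau}=\Gamma_\sigma\cup\Gamma_\tau^{\mathrm{op}}$; edges of $\Gamma_\sigma$ are called upper and edges of $\Gamma_\tau^{\mathrm{op}}$ lower, and an edge appearing in both is kept twice (once upper, once lower). A cycle is a closed walk traversing directed edges in their direction and undirected edges in either direction; its length is its number of edges. A cycle is alternating if no two consecutive edges (cyclically) are both upper or both lower. An alternating cycle $C$ is primitive if there is no collection of $k\ge 2$ nonempty alternating cycles $C_1,\dots,C_k$ such that the set of heads and tails of upper edges of $C$ coincides with the union of the sets of heads and tails of upper edges of $C_1,\dots,C_k$.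
   Formalization: As worded the claim fails: taking C twice splits every C. Here cycles are closed walks without repeated vertices, and primitivity compares heads and tails of upper edges separately, with disjoint unions (multiplicity counted). *)

theory Defs
  imports "HOL-Analysis.Analysis" "HOL-Library.Multiset"
begin

definition root_vec :: "'n::finite \<Rightarrow> 'n \<Rightarrow> real ^ 'n" where
  "root_vec i j = axis i 1 - axis j 1"

definition roots :: "(real ^ 'n::finite) set" where
  "roots = {root_vec i j | i j. i \<noteq> j}"

definition nonneg_span :: "(real ^ 'n::finite) set \<Rightarrow> (real ^ 'n) set" where
  "nonneg_span R = {(\<Sum>r\<in>R. c r *\<^sub>R r) | c. \<forall>r\<in>R. 0 \<le> c r}"

definition root_cone :: "(real ^ 'n::finite) set \<Rightarrow> bool" where
  "root_cone \<sigma> \<longleftrightarrow> (\<exists>R. finite R \<and> R \<subseteq> roots \<and> \<sigma> = nonneg_span R)"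

record 'v pdgraph =
  undirected :: "'v set set"
  directed :: "('v \<times> 'v) set"

definition cone_graph :: "(real ^ 'n::finite) set \<Rightarrow> 'n pdgraph" where
  "cone_graph \<sigma> =
     \<lparr> undirected = {{i, j} | i j. i \<noteq> j \<and> root_vec i j \<in> \<sigma> \<and> root_vec j i \<in> \<sigma>},
       directed = {(i, j). i \<noteq> j \<and> root_vec i j \<in> \<sigma> \<and> root_vec j i \<notin> \<sigma>} \<rparr>"

definition opposite :: "'v pdgraph \<Rightarrow> 'v pdgraph" where
  "opposite G = \<lparr> undirected = undirected G, directed = (directed G)\<inverse> \<rparr>"

datatype layer = Upper | Lower

text \<open>
  The union of the two graphs is kept as a family indexed by the layer, so that an edge belonging to
  both graphs occurs twice, once as an upper and once as a lower edge.
\<close>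

definition intersection_graph ::
    "(real ^ 'n::finite) set \<Rightarrow> (real ^ 'n) set \<Rightarrow> layer \<Rightarrow> 'n pdgraph" where
  "intersection_graph \<sigma> \<tau> l =
     (case l of Upper \<Rightarrow> cone_graph \<sigma> | Lower \<Rightarrow> opposite (cone_graph \<tau>))"

text \<open>
  A traversed edge is recorded as \<open>(l, i, j)\<close>: an edge of layer \<open>l\<close> traversed from its tail \<open>i\<close> to its
  head \<open>j\<close>. An undirected edge can be traversed in both directions.
\<close>

type_synonym 'v step = "layer \<times> 'v \<times> 'v"

definition step_layer :: "'v step \<Rightarrow> layer" where
  "step_layer s = fst s"

definition step_tail :: "'v step \<Rightarrow> 'v" where
  "step_tail s = fst (snd s)"

definition step_head :: "'v step \<Rightarrow> 'v" where
  "step_head s = snd (snd s)"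

definition steps :: "(layer \<Rightarrow> 'v pdgraph) \<Rightarrow> 'v step set" where
  "steps G = {(l, i, j). (i, j) \<in> directed (G l) \<or> {i, j} \<in> undirected (G l)}"

definition closed_walk :: "(layer \<Rightarrow> 'v pdgraph) \<Rightarrow> 'v step list \<Rightarrow> bool" where
  "closed_walk G C \<longleftrightarrow> set C \<subseteq> steps G \<and>
     (\<forall>k<length C. step_head (C ! k) = step_tail (C ! (Suc k mod length C)))"

text \<open>
  A cycle is a closed walk that visits no vertex twice. For closed walks with repeated vertices the
  characterization of intersections of root cones by primitive alternating cycles fails: let
  \<open>\<sigma>\<close> be generated by \<open>e\<^sub>0\<^sub>1, e\<^sub>2\<^sub>0, e\<^sub>4\<^sub>5\<close> and \<open>\<tau>\<close> by \<open>e\<^sub>2\<^sub>1, e\<^sub>4\<^sub>0, e\<^sub>0\<^sub>5\<close>. Then \<open>\<sigma> \<inter> \<tau>\<close> is generated by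
  \<open>e\<^sub>2\<^sub>1, e\<^sub>4\<^sub>5\<close>, but the alternating closed walk \<open>0, 1, 2, 0, 4, 5, 0\<close> starting with an upper edge
  cannot be split.
\<close>

definition cycle :: "(layer \<Rightarrow> 'v pdgraph) \<Rightarrow> 'v step list \<Rightarrow> bool" where
  "cycle G C \<longleftrightarrow> closed_walk G C \<and> distinct (map step_tail C)"

definition alternating_cycle :: "(layer \<Rightarrow> 'v pdgraph) \<Rightarrow> 'v step list \<Rightarrow> bool" where
  "alternating_cycle G C \<longleftrightarrow> cycle G C \<and>
     (\<forall>k<length C. step_layer (C ! k) \<noteq> step_layer (C ! (Suc k mod length C)))"

definition upper_heads :: "'v step list \<Rightarrow> 'v multiset" where
  "upper_heads C = mset (map step_head (filter (\<lambda>s. step_layer s = Upper) C))"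

definition upper_tails :: "'v step list \<Rightarrow> 'v multiset" where
  "upper_tails C = mset (map step_tail (filter (\<lambda>s. step_layer s = Upper) C))"

text \<open>
  Heads and tails are compared separately and with multiplicity; as the vertices of \<open>C\<close> are distinct,
  this says that the sets of upper heads of \<open>C\<close> and of upper tails of \<open>C\<close> are the disjoint unions of
  those of the cycles in \<open>Cs\<close>. With plain unions no cycle would be primitive, because of \<open>Cs = [C, C]\<close>.
\<close>

definition primitive :: "(layer \<Rightarrow> 'v pdgraph) \<Rightarrow> 'v step list \<Rightarrow> bool" where
  "primitive G C \<longleftrightarrow> alternating_cycle G C \<and>
     \<not> (\<exists>Cs. 2 \<le> length Cs \<and> (\<forall>D\<in>set Cs. D \<noteq> [] \<and> alternating_cycle G D) \<and>
          upper_heads C = sum_list (map upper_heads Cs) \<and>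
          upper_tails C = sum_list (map upper_tails Cs))"

end

theory Submission imports Defs begin

text \<open>
  Since \<open>e\<^sub>i\<^sub>k = e\<^sub>i\<^sub>j + e\<^sub>j\<^sub>k\<close>, a vector \<open>x\<close> of a root cone is a nonnegative combination of roots
  \<open>e\<^sub>i\<^sub>j\<close> of the cone with \<open>x\<^sub>i > 0 > x\<^sub>j\<close>: flow through a vertex can be rerouted past it. The sum of
  the upper roots of an alternating cycle equals the sum of its reversed lower roots, so it lies in
  both cones.

  For \<open>x \<in> \<sigma> \<inter> \<tau>\<close>, following alternately a bipartite flow for \<open>\<sigma>\<close> and one for \<open>\<tau>\<close> yields an alternating
  cycle whose vector can be peeled off \<open>x\<close>; hence \<open>\<sigma> \<inter> \<tau>\<close> is generated by vectors of alternating
  cycles. If all primitive cycles are short, splitting reduces these to cycles of length two, which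
  are common roots. Conversely, if \<open>\<sigma> \<inter> \<tau>\<close> is a root cone, a bipartite flow for the vector of a cycle
  is doubly stochastic, and Hall's theorem gives a perfect matching by common roots, which splits
  the cycle into cycles of length two.
\<close>

section \<open>Hall's marriage theorem\<close>

text \<open>Rado's argument, by induction on the total size of the sets. If no set has two elements,
  Hall's condition makes the forced choice injective. Otherwise submodularity of cardinality shows
  that one of two elements of some \<open>F i\<close> can be deleted without losing Hall's
  condition.\<close>

lemma Hall_marriage:
  fixes F :: "'a \<Rightarrow> 'b set"
  assumes "finite I" and "\<And>i. i \<in> I \<Longrightarrow> finite (F i)"
    and "\<And>J. J \<subseteq> I \<Longrightarrow> card J \<le> card (\<Union>(F ` J))"
  shows "\<exists>f. inj_on f I \<and> (\<forall>i\<in>I. f i \<in> F i)"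
  using assms
proof (induction "\<Sum>i\<in>I. card (F i)" arbitrary: F rule: less_induct)
  case less
  have finI: "finite I" and finF: "\<And>i. i \<in> I \<Longrightarrow> finite (F i)"
    and hall: "\<And>J. J \<subseteq> I \<Longrightarrow> card J \<le> card (\<Union>(F ` J))"
    using less.prems by auto
  show ?case
  proof (cases "\<exists>i\<in>I. \<exists>x\<in>F i. \<exists>y\<in>F i. x \<noteq> y")
    case False
    have ne: "F i \<noteq> {}" if "i \<in> I" for i
      using hall[of "{i}"] that by auto
    define f where "f i = (SOME x. x \<in> F i)" for i
    have f: "F i = {f i}" if "i \<in> I" for i
      using ne[OF that] False that some_in_eq[of "F i"] unfolding f_def by blast
    have "inj_on f I"
    proof (rule inj_onI, rule ccontr)
      fix i j assume ij: "i \<in> I" "j \<in> I" "f i = f j" "i \<noteq> j"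
      then have "\<Union>(F ` {i, j}) = {f i}" using f by auto
      then show False using hall[of "{i, j}"] ij by auto
    qed
    then show ?thesis using f by blast
  next
    case True
    then obtain i x y where i: "i \<in> I" and xy: "x \<in> F i" "y \<in> F i" "x \<noteq> y" by blast
    \<comment> \<open>Deleting \<open>z\<close> from \<open>F i\<close> affects only index sets
      containing \<open>i\<close>; such a set is \<open>J\<close> together with \<open>i\<close>,
      which explains the \<open>Suc\<close>.\<close>
    have shrink: ?thesis
      if "z \<in> F i" and h: "\<And>J. J \<subseteq> I - {i} \<Longrightarrow> Suc (card J) \<le> card (\<Union>(F ` J) \<union> (F i - {z}))" for z
    proof -
      let ?G = "F(i := F i - {z})"
      have "(\<Sum>k\<in>I. card (?G k)) < (\<Sum>k\<in>I. card (F k))"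
        using finI i finF[OF i] that(1)
        by (intro sum_strict_mono_ex1) (auto intro!: card_mono simp: card_Diff1_less simp del: card_Diff_insert intro!: bexI[of _ i])
      moreover have "card J \<le> card (\<Union>(?G ` J))" if J: "J \<subseteq> I" for J
      proof (cases "i \<in> J")
        case True
        have "\<Union>(?G ` J) = \<Union>(F ` (J - {i})) \<union> (F i - {z})" using True by auto
        moreover have "card J = Suc (card (J - {i}))"
          using True finI J by (metis card_Suc_Diff1 finite_subset)
        moreover have "J - {i} \<subseteq> I - {i}" using J by auto
        ultimately show ?thesis using h[of "J - {i}"] by simp
      next
        case False
        then have "\<Union>(?G ` J) = \<Union>(F ` J)" by auto
        then show ?thesis using hall[OF J] by simp
      qed
      moreover have "finite (?G k)" if "k \<in> I" for k using finF that by auto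
      ultimately have "\<exists>f. inj_on f I \<and> (\<forall>k\<in>I. f k \<in> ?G k)"
        using finI by (intro less.hyps)
      moreover have "?G k \<subseteq> F k" for k by auto
      ultimately show ?thesis by (meson subsetD)
    qed
    show ?thesis
    proof (rule ccontr)
      assume no: "\<not> ?thesis"
      obtain J where J: "J \<subseteq> I - {i}" "card (\<Union>(F ` J) \<union> (F i - {x})) \<le> card J"
        using shrink[OF xy(1)] no by (meson not_less_eq_eq)
      obtain L where L: "L \<subseteq> I - {i}" "card (\<Union>(F ` L) \<union> (F i - {y})) \<le> card L"
        using shrink[OF xy(2)] no by (meson not_less_eq_eq)
      let ?P = "\<Union>(F ` J) \<union> (F i - {x})" and ?Q = "\<Union>(F ` L) \<union> (F i - {y})"
      have fJL: "finite J" "finite L" using J L finI by (auto intro: finite_subset)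
      have fPQ: "finite ?P" "finite ?Q" using J L fJL finF i by auto
      have "card (insert i (J \<union> L)) \<le> card (\<Union>(F ` insert i (J \<union> L)))"
        using J L i by (intro hall) auto
      \<comment> \<open>Since \<open>x\<close> and \<open>y\<close> differ, the two punctured copies
        of \<open>F i\<close> together cover \<open>F i\<close>. The extra index \<open>i\<close>
        then contributes the one that breaks the submodular count.\<close>
      also have "\<Union>(F ` insert i (J \<union> L)) = ?P \<union> ?Q" using xy by auto
      finally have 1: "Suc (card (J \<union> L)) \<le> card (?P \<union> ?Q)"
        using J L fJL by (subst (asm) card_insert_disjoint) auto
      have "card (J \<inter> L) \<le> card (\<Union>(F ` (J \<inter> L)))"
        using J by (intro hall) auto
      also have "\<dots> \<le> card (?P \<inter> ?Q)"
        using fPQ by (intro card_mono) auto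
      finally have 2: "card (J \<inter> L) \<le> card (?P \<inter> ?Q)" .
      show False
        using 1 2 J(2) L(2) card_Un_Int[OF fJL] card_Un_Int[OF fPQ] by linarith
    qed
  qed
qed

section \<open>Flows on pairs of coordinates\<close>

text \<open>The pairs include the diagonal, where \<open>root_vec i i = 0\<close>; loops can
  therefore be discarded freely.\<close>

definition flow_vec :: "('n \<times> 'n \<Rightarrow> real) \<Rightarrow> real ^ 'n::finite" where
  "flow_vec p = (\<Sum>e\<in>UNIV. p e *\<^sub>R root_vec (fst e) (snd e))"

definition flow_on :: "('n \<times> 'n) set \<Rightarrow> ('n \<times> 'n \<Rightarrow> real) \<Rightarrow> bool" where
  "flow_on E p \<longleftrightarrow> (\<forall>e. 0 \<le> p e) \<and> (\<forall>e. 0 < p e \<longrightarrow> e \<in> E)"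

lemma flow_onD: "flow_on E p \<Longrightarrow> 0 \<le> p e" "flow_on E p \<Longrightarrow> 0 < p e \<Longrightarrow> e \<in> E"
  unfolding flow_on_def by blast+

text \<open>At a vertex with only out-flow or only in-flow this fixes the sign of the coordinate,
  which is how signs are read off below.\<close>

lemma flow_vec_nth: "flow_vec p $ v = (\<Sum>j\<in>UNIV. p (v, j)) - (\<Sum>i\<in>UNIV. p (i, v))"
proof -
  have "flow_vec p = (\<Sum>i\<in>UNIV. \<Sum>j\<in>UNIV. p (i, j) *\<^sub>R root_vec i j)"
    unfolding flow_vec_def by (simp add: sum.cartesian_product case_prod_beta flip: UNIV_Times_UNIV)
  then have "flow_vec p $ v =
      (\<Sum>i\<in>UNIV. \<Sum>j\<in>UNIV. (if i = v then p (i, j) else 0) - (if j = v then p (i, j) else 0))"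
    by (auto simp: root_vec_def axis_def if_distrib algebra_simps intro!: sum.cong)
  also have "\<dots> = (\<Sum>i\<in>UNIV. \<Sum>j\<in>UNIV. (if i = v then p (i, j) else 0)) - (\<Sum>i\<in>UNIV. p (i, v))"
    by (simp add: sum_subtractf)
  also have "(\<Sum>i\<in>UNIV. \<Sum>j\<in>UNIV. (if i = v then p (i, j) else 0)) = (\<Sum>j\<in>UNIV. p (v, j))"
    by (subst sum.swap) simp
  finally show ?thesis .
qed

lemma flow_vec_cong_offdiag:
  assumes "\<And>i j. i \<noteq> j \<Longrightarrow> p (i, j) = q (i, j)"
  shows "flow_vec p = flow_vec q"
  unfolding flow_vec_def
  by (rule sum.cong) (use assms in \<open>force simp: root_vec_def\<close>)+

lemma flow_vec_subtract_set:
  "flow_vec (\<lambda>e. p e - (if e \<in> E then \<epsilon> else 0)) =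
     flow_vec p - \<epsilon> *\<^sub>R (\<Sum>e\<in>E. root_vec (fst e) (snd e))"
proof -
  have "(\<Sum>e\<in>UNIV. (if e \<in> E then \<epsilon> else 0) *\<^sub>R root_vec (fst e) (snd e)) =
      (\<Sum>e\<in>UNIV. if e \<in> E then \<epsilon> *\<^sub>R root_vec (fst e) (snd e) else 0)"
    by (rule sum.cong) auto
  also have "\<dots> = (\<Sum>e\<in>E. \<epsilon> *\<^sub>R root_vec (fst e) (snd e))"
    by (subst sum.inter_restrict[symmetric]) auto
  finally show ?thesis
    unfolding flow_vec_def by (simp add: scaleR_left_diff_distrib sum_subtractf scaleR_sum_right)
qed

text \<open>Flow through \<open>k\<close> is rerouted along the direct edges \<open>(i, j)\<close>; the amount is proportional to
  \<open>p (i, k) * p (k, j)\<close>, so that either all in-flow or all out-flow of \<open>k\<close> disappears. If there is no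
  flow at \<open>k\<close>, the divisor is \<open>0\<close> and nothing changes.\<close>

lemma flow_eliminate_vertex:
  fixes p :: "'n::finite \<times> 'n \<Rightarrow> real"
  assumes p: "flow_on E p" and "trans E" and loop: "\<And>i. p (i, i) = 0"
  obtains q where "flow_on E q" "flow_vec q = flow_vec p" "\<And>i. q (i, i) = 0"
    "\<And>i j. 0 < q (i, j) \<Longrightarrow> (\<exists>j'. 0 < p (i, j')) \<and> (\<exists>i'. 0 < p (i', j))"
    "(\<forall>i. q (i, k) = 0) \<or> (\<forall>j. q (k, j) = 0)"
proof -
  define a where "a = (\<Sum>i\<in>UNIV. p (i, k))"
  define b where "b = (\<Sum>j\<in>UNIV. p (k, j))"
  define M where "M = max a b"
  \<comment> \<open>The second term is the rerouted flow; the last two take it away from the edges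
    into and out of \<open>k\<close>, where summing over the other endpoint produces
    \<open>b\<close> and \<open>a\<close>.\<close>
  define r where "r = (\<lambda>(i, j). p (i, j) + p (i, k) * p (k, j) / M
      - (if j = k then p (i, k) * b / M else 0) - (if i = k then p (k, j) * a / M else 0))"
  \<comment> \<open>Rerouting a path from \<open>i\<close> to \<open>k\<close> and back to
    \<open>i\<close> creates a loop, which carries the zero vector and is cut off.\<close>
  define q where "q = (\<lambda>(i, j). if i = j then 0 else r (i, j))"
  have nn: "0 \<le> p e" for e using p by (simp add: flow_onD)
  have ab: "0 \<le> a" "0 \<le> b" unfolding a_def b_def by (auto intro: sum_nonneg nn)
  have M: "0 \<le> M" "a \<le> M" "b \<le> M" using ab by (auto simp: M_def)
  have pa: "p (i, k) \<le> a" for i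
    unfolding a_def by (rule member_le_sum) (auto simp: nn)
  have pb: "p (k, j) \<le> b" for j
    unfolding b_def by (rule member_le_sum) (auto simp: nn)
  have r_in: "r (i, k) = p (i, k) * (1 - b / M)" if "i \<noteq> k" for i
    using that loop by (simp add: r_def algebra_simps)
  have r_out: "r (k, j) = p (k, j) * (1 - a / M)" if "j \<noteq> k" for j
    using that loop by (simp add: r_def algebra_simps)
  have le1: "a / M \<le> 1" "b / M \<le> 1" using M ab by (auto simp: divide_le_eq)
  have r_other: "r (i, j) = p (i, j) + p (i, k) * p (k, j) / M" if "i \<noteq> k" "j \<noteq> k" for i j
    using that by (simp add: r_def)
  have q_nn: "0 \<le> q (i, j)" for i j
  proof (cases "i = j")
    case False
    then show ?thesis
      using r_in[of i] r_out[of j] r_other[of i j] le1 M nn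
      by (cases "i = k"; cases "j = k") (auto simp: q_def)
  qed (simp add: q_def)
  \<comment> \<open>New flow arises only as the shortcut of a two-step path through
    \<open>k\<close>, so it stays in \<open>E\<close> by transitivity.\<close>
  have q_pos: "0 < p (i, j) \<or> (0 < p (i, k) \<and> 0 < p (k, j))" if "0 < q (i, j)" for i j
  proof (rule ccontr)
    assume "\<not> ?thesis"
    then have z: "p (i, j) = 0" "p (i, k) = 0 \<or> p (k, j) = 0" using nn by (auto simp: less_le)
    have "i \<noteq> j" using that by (auto simp: q_def)
    then have "q (i, j) = 0"
      using z r_in[of i] r_out[of j] r_other[of i j]
      by (cases "i = k"; cases "j = k") (auto simp: q_def)
    then show False using that by simp
  qed
  have split: "root_vec i j = root_vec i k + root_vec k j" for i j :: 'n
    by (simp add: root_vec_def)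
  have "flow_vec q = flow_vec r"
    by (rule flow_vec_cong_offdiag) (simp add: q_def)
  also have "\<dots> = (\<Sum>i\<in>UNIV. \<Sum>j\<in>UNIV. r (i, j) *\<^sub>R root_vec i j)"
    unfolding flow_vec_def by (simp add: sum.cartesian_product case_prod_beta flip: UNIV_Times_UNIV)
  also have "\<dots> = (\<Sum>i\<in>UNIV. \<Sum>j\<in>UNIV. p (i, j) *\<^sub>R root_vec i j)
      + (\<Sum>i\<in>UNIV. \<Sum>j\<in>UNIV. (p (i, k) * p (k, j) / M) *\<^sub>R root_vec i j)
      - (\<Sum>i\<in>UNIV. \<Sum>j\<in>UNIV. if j = k then (p (i, k) * b / M) *\<^sub>R root_vec i j else 0)
      - (\<Sum>i\<in>UNIV. \<Sum>j\<in>UNIV. if i = k then (p (k, j) * a / M) *\<^sub>R root_vec i j else 0)"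
    unfolding sum_subtractf[symmetric] sum.distrib[symmetric]
    by (intro sum.cong refl) (simp add: r_def algebra_simps)
  also have "(\<Sum>i\<in>UNIV. \<Sum>j\<in>UNIV. if i = k then (p (k, j) * a / M) *\<^sub>R root_vec i j else 0)
      = (\<Sum>j\<in>UNIV. (p (k, j) * a / M) *\<^sub>R root_vec k j)"
    by (subst sum.swap) simp
  also have "(\<Sum>i\<in>UNIV. \<Sum>j\<in>UNIV. (p (i, k) * p (k, j) / M) *\<^sub>R root_vec i j)
      = (\<Sum>i\<in>UNIV. \<Sum>j\<in>UNIV. (p (i, k) * p (k, j) / M) *\<^sub>R root_vec i k)
      + (\<Sum>i\<in>UNIV. \<Sum>j\<in>UNIV. (p (i, k) * p (k, j) / M) *\<^sub>R root_vec k j)"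
    unfolding sum.distrib[symmetric] scaleR_add_right[symmetric] by (simp flip: split)
  also have "(\<Sum>i\<in>UNIV. \<Sum>j\<in>UNIV. (p (i, k) * p (k, j) / M) *\<^sub>R root_vec k j)
      = (\<Sum>j\<in>UNIV. \<Sum>i\<in>UNIV. (p (i, k) * p (k, j) / M) *\<^sub>R root_vec k j)"
    by (rule sum.swap)
  also have "(\<Sum>i\<in>UNIV. \<Sum>j\<in>UNIV. (p (i, k) * p (k, j) / M) *\<^sub>R root_vec i k)
      = (\<Sum>i\<in>UNIV. (p (i, k) * b / M) *\<^sub>R root_vec i k)"
    by (simp add: b_def sum_distrib_left sum_divide_distrib flip: scaleR_sum_left)
  also have "(\<Sum>j\<in>UNIV. \<Sum>i\<in>UNIV. (p (i, k) * p (k, j) / M) *\<^sub>R root_vec k j)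
      = (\<Sum>j\<in>UNIV. (p (k, j) * a / M) *\<^sub>R root_vec k j)"
    by (simp add: a_def sum_distrib_left sum_divide_distrib mult.commute flip: scaleR_sum_left)
  finally have "flow_vec q = (\<Sum>i\<in>UNIV. \<Sum>j\<in>UNIV. p (i, j) *\<^sub>R root_vec i j)"
    by simp
  also have "\<dots> = flow_vec p"
    unfolding flow_vec_def by (simp add: sum.cartesian_product case_prod_beta flip: UNIV_Times_UNIV)
  finally have vec: "flow_vec q = flow_vec p" .
  have "(\<forall>i. q (i, k) = 0) \<or> (\<forall>j. q (k, j) = 0)"
  proof (cases "M = 0")
    case True
    then have "p (i, k) = 0" for i using pa[of i] nn[of "(i, k)"] M by linarith
    then have "q (i, k) = 0" for i using r_in[of i] by (auto simp: q_def)
    then show ?thesis by simp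
  next
    case False
    \<comment> \<open>If \<open>M = a\<close>, the factor \<open>1 - a / M\<close> kills the edges
      out of \<open>k\<close>; if \<open>M = b\<close>, the factor \<open>1 - b / M\<close> kills
      the edges into \<open>k\<close>.\<close>
    consider "M = a" | "M = b" unfolding M_def by linarith
    then show ?thesis
    proof cases
      case 1
      then show ?thesis using r_out False by (auto simp: q_def)
    next
      case 2
      then show ?thesis using r_in False by (auto simp: q_def)
    qed
  qed
  moreover have "flow_on E q"
    unfolding flow_on_def using q_nn q_pos flow_onD(2)[OF p] \<open>trans E\<close>
    by (metis surj_pair transD)
  moreover have "q (i, i) = 0" for i by (simp add: q_def)
  ultimately show thesis using that vec q_pos by blast
qed

text \<open>Vertices are treated one at a time. Rerouting gives no vertex out-flow or in-flow that
  it lacked before, so vertices treated earlier stay pure sources or pure sinks.\<close>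

lemma flow_eliminate_vertices:
  fixes p :: "'n::finite \<times> 'n \<Rightarrow> real"
  assumes p: "flow_on E p" and "trans E" and "finite K"
  shows "\<exists>q. flow_on E q \<and> flow_vec q = flow_vec p \<and> (\<forall>i. q (i, i) = 0) \<and>
    (\<forall>k\<in>K. (\<forall>i. q (i, k) = 0) \<or> (\<forall>j. q (k, j) = 0))"
  using \<open>finite K\<close>
proof induction
  case empty
  \<comment> \<open>The elimination of a vertex starts from a flow without loops, so these are
    removed first.\<close>
  define q where "q = (\<lambda>(i, j). if i = j then 0 else p (i, j))"
  have "flow_vec q = flow_vec p" by (rule flow_vec_cong_offdiag) (simp add: q_def)
  moreover have "flow_on E q" using p by (auto simp: flow_on_def q_def)
  moreover have "q (i, i) = 0" for i by (simp add: q_def)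
  ultimately show ?case by blast
next
  case (insert k K)
  then obtain q where q: "flow_on E q" "flow_vec q = flow_vec p" "\<And>i. q (i, i) = 0"
    "\<forall>k\<in>K. (\<forall>i. q (i, k) = 0) \<or> (\<forall>j. q (k, j) = 0)" by blast
  obtain r where r: "flow_on E r" "flow_vec r = flow_vec q" "\<And>i. r (i, i) = 0"
    "\<And>i j. 0 < r (i, j) \<Longrightarrow> (\<exists>j'. 0 < q (i, j')) \<and> (\<exists>i'. 0 < q (i', j))"
    "(\<forall>i. r (i, k) = 0) \<or> (\<forall>j. r (k, j) = 0)"
    using flow_eliminate_vertex[OF q(1) \<open>trans E\<close> q(3)] by metis
  have rz: "r e = 0 \<longleftrightarrow> \<not> 0 < r e" for e using flow_onD(1)[OF r(1), of e] by auto
  have "(\<forall>i. r (i, l) = 0) \<or> (\<forall>j. r (l, j) = 0)" if "l \<in> K" for l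
    using q(4) that r(4) rz by (metis less_irrefl)
  then show ?case using r q(2) by (intro exI[of _ r]) auto
qed

text \<open>After eliminating every vertex, the tail of an edge with flow has no in-flow and its
  head no out-flow, so their coordinates are positive and negative.\<close>

lemma flow_bipartite:
  assumes p: "flow_on E p" and "trans E" and x: "flow_vec p = x"
  obtains q where "flow_on (E \<inter> {i. 0 < x $ i} \<times> {j. x $ j < 0}) q" "flow_vec q = x"
proof -
  obtain q where q: "flow_on E q" "flow_vec q = x" 
    "\<And>k. (\<forall>i. q (i, k) = 0) \<or> (\<forall>j. q (k, j) = 0)"
    using flow_eliminate_vertices[OF p \<open>trans E\<close> finite_class.finite_UNIV] x by blast
  have nn: "0 \<le> q e" for e using q(1) by (rule flow_onD)
  have "0 < x $ i \<and> x $ j < 0" if ij: "0 < q (i, j)" for i j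
  proof
    have "(\<Sum>k\<in>UNIV. q (k, i)) = 0" using q(3)[of i] ij by auto
    moreover have "q (i, j) \<le> (\<Sum>k\<in>UNIV. q (i, k))" by (rule member_le_sum) (auto simp: nn)
    ultimately show "0 < x $ i" using ij flow_vec_nth[of q i] q(2) by simp
    have "(\<Sum>k\<in>UNIV. q (j, k)) = 0" using q(3)[of j] ij by auto
    moreover have "q (i, j) \<le> (\<Sum>k\<in>UNIV. q (k, j))" by (rule member_le_sum) (auto simp: nn)
    ultimately show "x $ j < 0" using ij flow_vec_nth[of q j] q(2) by simp
  qed
  then have "flow_on (E \<inter> {i. 0 < x $ i} \<times> {j. x $ j < 0}) q"
    using q(1) by (auto simp: flow_on_def)
  then show thesis using that q(2) by blast
qed

section \<open>Root cones\<close>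

lemma finite_roots: "finite (roots :: (real ^ 'n::finite) set)"
proof -
  have "(roots :: (real ^ 'n) set) \<subseteq> (\<lambda>(i, j). root_vec i j) ` UNIV"
    by (auto simp: roots_def)
  then show ?thesis by (rule finite_subset) simp
qed

lemma nonneg_span_zero: "0 \<in> nonneg_span R"
  unfolding nonneg_span_def by (rule CollectI, rule exI[of _ "\<lambda>_. 0"]) simp

lemma nonneg_span_add:
  assumes "x \<in> nonneg_span R" "y \<in> nonneg_span R"
  shows "x + y \<in> nonneg_span R"
proof -
  obtain c d where "x = (\<Sum>r\<in>R. c r *\<^sub>R r)" "\<forall>r\<in>R. 0 \<le> c r" "y = (\<Sum>r\<in>R. d r *\<^sub>R r)" "\<forall>r\<in>R. 0 \<le> d r"
    using assms by (auto simp: nonneg_span_def)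
  then show ?thesis
    unfolding nonneg_span_def
    by (intro CollectI exI[of _ "\<lambda>r. c r + d r"]) (simp add: scaleR_left_distrib sum.distrib)
qed

lemma nonneg_span_scale:
  assumes "x \<in> nonneg_span R" "0 \<le> t"
  shows "t *\<^sub>R x \<in> nonneg_span R"
proof -
  obtain c where "x = (\<Sum>r\<in>R. c r *\<^sub>R r)" "\<forall>r\<in>R. 0 \<le> c r"
    using assms by (auto simp: nonneg_span_def)
  then show ?thesis
    unfolding nonneg_span_def using assms(2)
    by (intro CollectI exI[of _ "\<lambda>r. t * c r"]) (simp add: scaleR_sum_right)
qed

lemma nonneg_span_base:
  assumes "finite R" "r \<in> R"
  shows "r \<in> nonneg_span R"
  unfolding nonneg_span_def
  by (rule CollectI, rule exI[of _ "\<lambda>s. if s = r then 1 else 0"])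
     (use assms in \<open>simp add: if_distrib[of "\<lambda>c. c *\<^sub>R _"] cong: if_cong\<close>)

lemma nonneg_span_sum:
  assumes "\<And>i. i \<in> I \<Longrightarrow> f i \<in> nonneg_span R"
  shows "sum f I \<in> nonneg_span R"
  using assms by (induction I rule: infinite_finite_induct) (auto intro: nonneg_span_zero nonneg_span_add)

lemma nonneg_span_sum_list:
  assumes "\<And>x. x \<in> set xs \<Longrightarrow> x \<in> nonneg_span R"
  shows "sum_list xs \<in> nonneg_span R"
  using assms by (induction xs) (auto intro: nonneg_span_zero nonneg_span_add)

lemma root_vec_inject:
  assumes "root_vec i j = root_vec k l" "i \<noteq> j"
  shows "i = k \<and> j = l"
proof -
  have "root_vec i j $ i = root_vec k l $ i" "root_vec i j $ j = root_vec k l $ j"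
    using assms(1) by simp_all
  then show ?thesis using assms(2) by (auto simp: root_vec_def axis_def split: if_splits)
qed

lemma nonneg_span_flow:
  assumes R: "R \<subseteq> roots" and x: "x \<in> nonneg_span R"
  obtains p where "flow_on {(i, j). root_vec i j \<in> R} p" "flow_vec p = x"
proof -
  obtain c where c: "x = (\<Sum>r\<in>R. c r *\<^sub>R r)" "\<forall>r\<in>R. 0 \<le> c r"
    using x by (auto simp: nonneg_span_def)
  let ?v = "\<lambda>e. root_vec (fst e) (snd e)"
  \<comment> \<open>Off the diagonal a root determines its pair, so each coefficient is assigned to
    exactly one pair.\<close>
  define D where "D = {e. fst e \<noteq> snd e \<and> ?v e \<in> R}"
  define p where "p e = (if e \<in> D then c (?v e) else 0)" for e
  have inj: "inj_on ?v D"
    by (rule inj_onI) (auto simp: D_def dest: root_vec_inject)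
  have "?v ` D = R"
    using R by (force simp: D_def roots_def image_iff)
  then have "x = (\<Sum>e\<in>D. c (?v e) *\<^sub>R ?v e)"
    unfolding c(1) using inj by (auto simp: sum.reindex)
  also have "\<dots> = (\<Sum>e\<in>UNIV. if e \<in> D then c (?v e) *\<^sub>R ?v e else 0)"
    by (subst sum.inter_restrict[symmetric]) auto
  also have "\<dots> = flow_vec p"
    unfolding flow_vec_def by (rule sum.cong) (auto simp: p_def)
  finally have "flow_vec p = x" ..
  moreover have "flow_on {(i, j). root_vec i j \<in> R} p"
    using c(2) by (auto simp: flow_on_def p_def D_def)
  ultimately show thesis using that by blast
qed

text \<open>The pairs whose root lies in the cone form a transitive relation, because the cone is
  closed under addition; hence rerouting never leaves the cone.\<close>

lemma root_cone_bipartite_flow: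
  assumes "root_cone \<sigma>" and "x \<in> \<sigma>"
  obtains p where "flow_on ({(i, j). root_vec i j \<in> \<sigma>} \<inter> {i. 0 < x $ i} \<times> {j. x $ j < 0}) p"
    "flow_vec p = x"
proof -
  obtain R where R: "finite R" "R \<subseteq> roots" "\<sigma> = nonneg_span R"
    using assms(1) by (auto simp: root_cone_def)
  obtain p where p: "flow_on {(i, j). root_vec i j \<in> R} p" "flow_vec p = x"
    using nonneg_span_flow[OF R(2)] assms(2) R(3) by metis
  have "flow_on {(i, j). root_vec i j \<in> \<sigma>} p"
    using p(1) nonneg_span_base[OF R(1)] R(3) by (auto simp: flow_on_def)
  moreover have "root_vec i k = root_vec i j + root_vec j k" for i j k :: 'a
    by (simp add: root_vec_def)
  then have "trans {(i, j). root_vec i j \<in> \<sigma>}"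
    unfolding R(3) by (intro transI) (metis (no_types, lifting) case_prodD case_prodI mem_Collect_eq nonneg_span_add)
  ultimately show thesis using flow_bipartite p(2) that by blast
qed

section \<open>Alternating cycles\<close>

text \<open>An undirected edge may be traversed both ways, so for steps the distinction between the
  two kinds of edges disappears.\<close>

lemma steps_intersection_graph:
  "(Upper, i, j) \<in> steps (intersection_graph \<sigma> \<tau>) \<longleftrightarrow> i \<noteq> j \<and> root_vec i j \<in> \<sigma>"
  "(Lower, i, j) \<in> steps (intersection_graph \<sigma> \<tau>) \<longleftrightarrow> i \<noteq> j \<and> root_vec j i \<in> \<tau>"
  unfolding steps_def intersection_graph_def cone_graph_def opposite_def
  by (auto simp: doubleton_eq_iff)

text \<open>Expressed through exactly the multisets compared in \<open>primitive\<close>, so that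
  splitting a cycle splits its vector additively.\<close>

definition cycle_vec :: "'n::finite step list \<Rightarrow> real ^ 'n" where
  "cycle_vec C = (\<Sum>i\<in>#upper_tails C. axis i 1) - (\<Sum>j\<in>#upper_heads C. axis j 1)"

lemma cycle_vec_upper:
  "cycle_vec C = (\<Sum>s\<leftarrow>filter (\<lambda>s. step_layer s = Upper) C. root_vec (step_tail s) (step_head s))"
  by (induction C) (auto simp: cycle_vec_def upper_tails_def upper_heads_def root_vec_def)

lemma inj_on_Suc_mod: "inj_on (\<lambda>k. Suc k mod n) {..<n}"
  by (auto simp: inj_on_def mod_Suc split: if_splits)

text \<open>The head of each step is the tail of the next, and the cyclic shift permutes the
  indices, so the sum telescopes.\<close>

lemma closed_walk_vec:
  assumes "closed_walk G C"
  shows "(\<Sum>s\<leftarrow>C. root_vec (step_tail s) (step_head s)) = 0"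
proof -
  let ?n = "length C" and ?a = "\<lambda>k. axis (step_tail (C ! k)) 1 :: real ^ 'a"
  have "(\<lambda>k. Suc k mod ?n) ` {..<?n} = {..<?n}"
    by (rule endo_inj_surj) (auto intro: inj_on_Suc_mod mod_less_divisor)
  then have bij: "bij_betw (\<lambda>k. Suc k mod ?n) {..<?n} {..<?n}"
    by (simp add: bij_betw_def inj_on_Suc_mod)
  have "(\<Sum>s\<leftarrow>C. root_vec (step_tail s) (step_head s)) =
      (\<Sum>k<?n. root_vec (step_tail (C ! k)) (step_head (C ! k)))"
    by (simp add: sum_list_sum_nth atLeast0LessThan)
  also have "\<dots> = (\<Sum>k<?n. ?a k - ?a (Suc k mod ?n))"
    using assms by (intro sum.cong) (auto simp: root_vec_def closed_walk_def)
  also have "\<dots> = 0"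
    using sum.reindex_bij_betw[OF bij, of ?a] by (simp add: sum_subtractf)
  finally show ?thesis .
qed

text \<open>All steps together sum to zero, so the upper roots balance the lower ones, and reversing
  the latter absorbs the sign.\<close>

lemma cycle_vec_lower:
  assumes "closed_walk G C"
  shows "cycle_vec C = (\<Sum>s\<leftarrow>filter (\<lambda>s. step_layer s \<noteq> Upper) C. root_vec (step_head s) (step_tail s))"
proof -
  have "(\<Sum>s\<leftarrow>C. root_vec (step_tail s) (step_head s)) = cycle_vec C
      - (\<Sum>s\<leftarrow>filter (\<lambda>s. step_layer s \<noteq> Upper) C. root_vec (step_head s) (step_tail s))"
    unfolding cycle_vec_upper by (induction C) (auto simp: root_vec_def algebra_simps)
  then show ?thesis using closed_walk_vec[OF assms] by simp
qed

text \<open>Of the two expressions for the vector, the upper one is a sum of roots of \<sigma> and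
  the lower one a sum of roots of \<tau>.\<close>

lemma cycle_vec_in_cones:
  assumes "root_cone \<sigma>" "root_cone \<tau>" and C: "closed_walk (intersection_graph \<sigma> \<tau>) C"
  shows "cycle_vec C \<in> \<sigma> \<inter> \<tau>"
proof
  have st: "s \<in> steps (intersection_graph \<sigma> \<tau>)" if "s \<in> set C" for s
    using C that by (auto simp: closed_walk_def)
  obtain R where R: "\<sigma> = nonneg_span R" using assms(1) by (auto simp: root_cone_def)
  show "cycle_vec C \<in> \<sigma>"
    unfolding cycle_vec_upper R
  proof (rule nonneg_span_sum_list, clarsimp simp only: set_map set_filter)
    fix s assume "s \<in> set C" "step_layer s = Upper"
    then have "(Upper, step_tail s, step_head s) \<in> steps (intersection_graph \<sigma> \<tau>)"
      using st[of s] by (metis prod.collapse step_head_def step_layer_def step_tail_def)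
    then show "root_vec (step_tail s) (step_head s) \<in> nonneg_span R"
      using R steps_intersection_graph(1) by metis
  qed
  obtain T where T: "\<tau> = nonneg_span T" using assms(2) by (auto simp: root_cone_def)
  show "cycle_vec C \<in> \<tau>"
    unfolding cycle_vec_lower[OF C] T
  proof (rule nonneg_span_sum_list, clarsimp simp only: set_map set_filter)
    fix s assume "s \<in> set C" "step_layer s \<noteq> Upper"
    then have "(Lower, step_tail s, step_head s) \<in> steps (intersection_graph \<sigma> \<tau>)"
      using st[of s] by (metis layer.exhaust prod.collapse step_head_def step_layer_def step_tail_def)
    then show "root_vec (step_head s) (step_tail s) \<in> nonneg_span T"
      using T steps_intersection_graph(2) by metis
  qed
qed

text \<open>The last lower step ends in \<open>a m\<close>, so the walk closes up when
  \<open>a m = a 0\<close>; distinctness concerns indices below \<open>m\<close> only.\<close>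

definition zigzag :: "(nat \<Rightarrow> 'v) \<Rightarrow> (nat \<Rightarrow> 'v) \<Rightarrow> nat \<Rightarrow> 'v step list" where
  "zigzag a b m = concat (map (\<lambda>k. [(Upper, a k, b k), (Lower, b k, a (Suc k))]) [0..<m])"

lemma zigzag_Suc: "zigzag a b (Suc m) = zigzag a b m @ [(Upper, a m, b m), (Lower, b m, a (Suc m))]"
  by (simp add: zigzag_def)

lemma length_zigzag: "length (zigzag a b m) = 2 * m"
  by (induction m) (auto simp: zigzag_Suc, simp add: zigzag_def)

lemma set_zigzag:
  "set (zigzag a b m) = (\<Union>k<m. {(Upper, a k, b k), (Lower, b k, a (Suc k))})"
  by (auto simp: zigzag_def)

lemma nth_zigzag:
  assumes "k < m"
  shows "zigzag a b m ! (2 * k) = (Upper, a k, b k)"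
    and "zigzag a b m ! Suc (2 * k) = (Lower, b k, a (Suc k))"
  using assms
  by (induction m) (auto simp: zigzag_Suc nth_append length_zigzag less_Suc_eq)

lemma distinct_tails_zigzag:
  assumes "inj_on a {..<m}" "inj_on b {..<m}" "\<And>k l. k < m \<Longrightarrow> l < m \<Longrightarrow> a k \<noteq> b l"
  shows "distinct (map step_tail (zigzag a b m))"
  using assms
proof (induction m)
  case 0
  then show ?case by (simp add: zigzag_def)
next
  case (Suc m)
  have "inj_on a {..<m}" "inj_on b {..<m}" using Suc.prems by (auto intro: inj_on_subset)
  then have IH: "distinct (map step_tail (zigzag a b m))" using Suc by auto
  have "step_tail ` set (zigzag a b m) = a ` {..<m} \<union> b ` {..<m}"
    by (auto simp: set_zigzag step_tail_def image_iff)
  moreover have "a m \<notin> a ` {..<m}" "b m \<notin> b ` {..<m}"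
    using Suc.prems(1,2) by (auto simp: lessThan_Suc)
  moreover have "a m \<notin> b ` {..<m}" "b m \<notin> a ` {..<m}" "a m \<noteq> b m"
    using Suc.prems(3)[of m] Suc.prems(3)[of _ m] by (auto simp: image_iff) (metis less_Suc_eq)+
  moreover have "step_tail (l, i, j) = i" for l and i j :: 'a by (simp add: step_tail_def)
  ultimately show ?case using IH by (simp add: zigzag_Suc)
qed

lemma alternating_cycle_zigzag:
  assumes "a m = a 0" "inj_on a {..<m}" "inj_on b {..<m}"
    and "\<And>k l. k < m \<Longrightarrow> l < m \<Longrightarrow> a k \<noteq> b l"
    and "\<And>k. k < m \<Longrightarrow> (Upper, a k, b k) \<in> steps G"
    and "\<And>k. k < m \<Longrightarrow> (Lower, b k, a (Suc k)) \<in> steps G"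
  shows "alternating_cycle G (zigzag a b m)"
proof -
  let ?C = "zigzag a b m"
  have next': "step_head (?C ! k) = step_tail (?C ! (Suc k mod length ?C)) \<and>
      step_layer (?C ! k) \<noteq> step_layer (?C ! (Suc k mod length ?C))" if "k < length ?C" for k
  proof (cases "even k")
    case True
    then obtain l where l: "k = 2 * l" by blast
    then have "l < m" "Suc k mod length ?C = Suc (2 * l)" using that by (auto simp: length_zigzag)
    then show ?thesis using l nth_zigzag[of l m a b] by (simp add: step_head_def step_tail_def step_layer_def)
  next
    case False
    then obtain l where l: "k = Suc (2 * l)" by (auto elim: oddE)
    then have lm: "l < m" using that by (auto simp: length_zigzag)
    show ?thesis
    proof (cases "Suc l = m")
      case True
      \<comment> \<open>The last lower step wraps around to index 0, which is where
        \<open>a m = a 0\<close> enters.\<close>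
      then have "Suc k mod length ?C = 2 * 0" using l by (auto simp: length_zigzag)
      then show ?thesis using l lm True nth_zigzag[of l m a b] nth_zigzag[of 0 m a b] assms(1)
        by (simp add: step_head_def step_tail_def step_layer_def)
    next
      case False
      then have s: "Suc k mod length ?C = 2 * Suc l" using l lm by (auto simp: length_zigzag)
      show ?thesis unfolding s using l lm False nth_zigzag[of l m a b] nth_zigzag[of "Suc l" m a b]
        by (simp add: step_head_def step_tail_def step_layer_def)
    qed
  qed
  show ?thesis
    unfolding alternating_cycle_def cycle_def closed_walk_def
    using next' distinct_tails_zigzag[OF assms(2,3,4)] assms(5,6) by (auto simp: set_zigzag)
qed

lemma upper_zigzag:
  "upper_tails (zigzag a b m) = mset (map a [0..<m])"
  "upper_heads (zigzag a b m) = mset (map b [0..<m])"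
  by (induction m)
     (auto simp: zigzag_Suc upper_tails_def upper_heads_def step_layer_def step_tail_def step_head_def,
      simp_all add: zigzag_def)

lemma cycle_vec_zigzag: "cycle_vec (zigzag a b m) = (\<Sum>k<m. root_vec (a k) (b k))"
  by (simp add: cycle_vec_def upper_zigzag root_vec_def sum_subtractf image_mset.compositionality
      comp_def sum_unfold_sum_mset[symmetric] atLeast0LessThan[symmetric])

section \<open>Decomposition into alternating cycles\<close>

text \<open>By pigeonhole an orbit repeats a value; that value is periodic, and its least period
  gives an injective orbit segment.\<close>

lemma finite_self_map_periodic:
  fixes h :: "'a \<Rightarrow> 'a"
  assumes "finite A" "z \<in> A" "\<And>x. x \<in> A \<Longrightarrow> h x \<in> A"
  obtains a m where "a \<in> A" "0 < m" "(h ^^ m) a = a" "inj_on (\<lambda>k. (h ^^ k) a) {..<m}"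
proof -
  have orb: "(h ^^ k) x \<in> A" if "x \<in> A" for k x using assms(3) that by (induction k) auto
  have "\<not> inj_on (\<lambda>k. (h ^^ k) z) (UNIV :: nat set)"
  proof
    assume "inj (\<lambda>k. (h ^^ k) z)"
    then have "infinite (range (\<lambda>k. (h ^^ k) z))" by (rule range_inj_infinite)
    moreover have "range (\<lambda>k. (h ^^ k) z) \<subseteq> A" using orb assms(2) by auto
    ultimately show False using assms(1) finite_subset by blast
  qed
  then obtain k l where kl: "k < l" "(h ^^ k) z = (h ^^ l) z"
    unfolding inj_on_def by (metis linorder_neqE_nat)
  define a where "a = (h ^^ k) z"
  have aA: "a \<in> A" using orb assms(2) by (simp add: a_def)
  have "(h ^^ (l - k)) a = (h ^^ ((l - k) + k)) z" unfolding a_def funpow_add by simp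
  then have per: "0 < l - k \<and> (h ^^ (l - k)) a = a" using kl by (simp add: a_def)
  define m where "m = (LEAST m. 0 < m \<and> (h ^^ m) a = a)"
  have m: "0 < m" "(h ^^ m) a = a" using LeastI[of "\<lambda>m. 0 < m \<and> (h ^^ m) a = a", OF per] by (auto simp: m_def)
  have least: "m \<le> i" if "0 < i" "(h ^^ i) a = a" for i
    unfolding m_def using that by (intro Least_le) auto
  \<comment> \<open>If iterates \<open>i < j < m\<close> agreed, applying \<open>h\<close> another
    \<open>m - j\<close> times would return to \<open>a\<close> after fewer than \<open>m\<close>
    steps.\<close>
  have "\<not> ((h ^^ i) a = (h ^^ j) a)" if "i < j" "j < m" for i j
  proof
    assume eq: "(h ^^ i) a = (h ^^ j) a"
    have "(h ^^ (m - j + i)) a = (h ^^ (m - j)) ((h ^^ j) a)" unfolding funpow_add by (simp add: eq)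
    also have "\<dots> = (h ^^ (m - j + j)) a" unfolding funpow_add by simp
    finally have "(h ^^ (m - j + i)) a = a" using that m by simp
    then have "m \<le> m - j + i" using that by (intro least) auto
    then show False using that by linarith
  qed
  then have "inj_on (\<lambda>k. (h ^^ k) a) {..<m}"
    by (intro inj_onI) (metis lessThan_iff linorder_neqE_nat)
  then show thesis using that aA m by blast
qed

text \<open>Induction on the number of positive entries of both flows: a cycle found along them is
  subtracted with the largest weight keeping both nonnegative, which clears an entry. The sets
  \<open>A\<close> and \<open>B\<close> stay fixed while \<open>x\<close>, and with it the sign
  pattern, changes.\<close>

lemma flow_vec_in_span_of_cycles:
  fixes p q :: "'n::finite \<times> 'n \<Rightarrow> real"
  assumes "\<And>C. alternating_cycle (intersection_graph \<sigma> \<tau>) C \<Longrightarrow> cycle_vec C \<in> nonneg_span R"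
    and "A \<inter> B = {}"
    and "flow_on ({(i, j). root_vec i j \<in> \<sigma>} \<inter> A \<times> B) p" "flow_vec p = x"
    and "flow_on ({(i, j). root_vec i j \<in> \<tau>} \<inter> A \<times> B) q" "flow_vec q = x"
  shows "x \<in> nonneg_span R"
  using assms(3-6)
proof (induction "card {e. 0 < p e} + card {e. 0 < q e}" arbitrary: p q x rule: less_induct)
  case less
  note p = less.prems(1,2) and q = less.prems(3,4)
  have pn: "0 \<le> p e" and qn: "0 \<le> q e" for e using p q by (auto intro: flow_onD)
  have pAB: "i \<in> A \<and> j \<in> B \<and> root_vec i j \<in> \<sigma>" if "0 < p (i, j)" for i j
    using flow_onD(2)[OF p(1) that] by auto
  have qAB: "i \<in> A \<and> j \<in> B \<and> root_vec i j \<in> \<tau>" if "0 < q (i, j)" for i j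
    using flow_onD(2)[OF q(1) that] by auto
  \<comment> \<open>Here \<open>r\<close> is either of the two flows. As \<open>A\<close> and
    \<open>B\<close> are disjoint, a vertex of \<open>A\<close> has no in-flow.\<close>
  have x_pos: "0 < x $ i" if "0 < r (i, j)" "flow_vec r = x" "\<And>e. 0 \<le> r e"
    "\<And>i j. 0 < r (i, j) \<Longrightarrow> i \<in> A \<and> j \<in> B" for r i j
  proof -
    have "r (k, i) = 0" for k using that(1,3,4) assms(2) by (metis IntI empty_iff less_le)
    moreover have "r (i, j) \<le> (\<Sum>k\<in>UNIV. r (i, k))" by (rule member_le_sum) (auto simp: that)
    ultimately show ?thesis using that(1) flow_vec_nth[of r i] that(2) by simp
  qed
  have x_neg: "x $ j < 0" if "0 < r (i, j)" "flow_vec r = x" "\<And>e. 0 \<le> r e"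
    "\<And>i j. 0 < r (i, j) \<Longrightarrow> i \<in> A \<and> j \<in> B" for r i j
  proof -
    have "r (j, k) = 0" for k using that(1,3,4) assms(2) by (metis IntI empty_iff less_le)
    moreover have "r (i, j) \<le> (\<Sum>k\<in>UNIV. r (k, j))" by (rule member_le_sum) (auto simp: that)
    ultimately show ?thesis using that(1) flow_vec_nth[of r j] that(2) by simp
  qed
  have "\<exists>j. 0 < p (i, j) \<and> x $ j < 0" if "0 < x $ i" for i
  proof -
    have "\<exists>j. 0 < p (i, j)"
    proof (rule ccontr)
      assume "\<not> ?thesis"
      then have "p (i, j) = 0" for j using pn by (metis less_le)
      then show False using flow_vec_nth[of p i] p(2) that sum_nonneg[of UNIV "\<lambda>j. p (j, i)"] pn by simp
    qed
    then show ?thesis using x_neg[OF _ p(2) pn] pAB by blast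
  qed
  then obtain \<phi> where \<phi>: "\<And>i. 0 < x $ i \<Longrightarrow> 0 < p (i, \<phi> i) \<and> x $ \<phi> i < 0" by metis
  have "\<exists>i. 0 < q (i, j) \<and> 0 < x $ i" if "x $ j < 0" for j
  proof -
    have "\<exists>i. 0 < q (i, j)"
    proof (rule ccontr)
      assume "\<not> ?thesis"
      then have "q (i, j) = 0" for i using qn by (metis less_le)
      then show False using flow_vec_nth[of q j] q(2) that sum_nonneg[of UNIV "\<lambda>i. q (j, i)"] qn by simp
    qed
    then show ?thesis using x_pos[OF _ q(2) qn] qAB by blast
  qed
  \<comment> \<open>While \<phi> follows an edge of \<open>p\<close> forwards, \<psi> follows an
    edge of \<open>q\<close> backwards, matching the reversal of lower edges.\<close>
  then obtain \<psi> where \<psi>: "\<And>j. x $ j < 0 \<Longrightarrow> 0 < q (\<psi> j, j) \<and> 0 < x $ \<psi> j" by metis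
  show ?case
  proof (cases "\<exists>i. 0 < x $ i")
    case False
    then have "p (i, j) = 0" for i j using x_pos[OF _ p(2) pn] pAB pn by (metis less_le)
    then have "p = (\<lambda>_. 0)" by auto
    then have "x = 0" using p(2) by (auto simp: flow_vec_def)
    then show ?thesis by (simp add: nonneg_span_zero)
  next
    case True
    then obtain z where z: "0 < x $ z" by blast
    define h where "h = \<psi> \<circ> \<phi>"
    have h: "h i \<in> {i. 0 < x $ i}" if "i \<in> {i. 0 < x $ i}" for i using \<phi> \<psi> that by (simp add: h_def)
    obtain y m where y: "0 < x $ y" and m: "0 < m" "(h ^^ m) y = y" and inj: "inj_on (\<lambda>k. (h ^^ k) y) {..<m}"
      using finite_self_map_periodic[of "{i. 0 < x $ i}" z h] z h by auto
    define a where "a k = (h ^^ k) y" for k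
    define b where "b k = \<phi> (a k)" for k
    have aS: "a (Suc k) = \<psi> (b k)" for k by (simp add: a_def b_def h_def)
    have apos: "0 < x $ a k" for k by (induction k) (use y h in \<open>auto simp: a_def\<close>)
    have am: "a m = a 0" using m by (simp add: a_def)
    have pe: "0 < p (a k, b k)" and bneg: "x $ b k < 0" for k
      using \<phi>[OF apos[of k]] by (auto simp: b_def)
    have qe: "0 < q (a (Suc k), b k)" for k using \<psi>[OF bneg[of k]] by (simp add: aS)
    have ainj: "inj_on a {..<m}" using inj by (simp add: a_def[abs_def])
    \<comment> \<open>The shifted sequence is a cyclic rotation of \<open>a\<close>. Since \<psi>
      maps \<open>b k\<close> to \<open>a (Suc k)\<close>, injectivity then passes back to
      \<open>b\<close>.\<close>
    have aSinj: "inj_on (\<lambda>k. a (Suc k)) {..<m}"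
    proof -
      have "inj_on (a \<circ> (\<lambda>k. Suc k mod m)) {..<m}"
        using inj_on_Suc_mod ainj m(1) by (intro comp_inj_on) (auto elim: inj_on_subset)
      moreover have "a (Suc k) = a (Suc k mod m)" if "k < m" for k
        using that am by (cases "Suc k = m") auto
      ultimately show ?thesis
        by (simp add: inj_on_def)
    qed
    have binj: "inj_on b {..<m}"
      using aSinj by (auto simp: inj_on_def aS)
    have ab: "a k \<noteq> b l" for k l using apos[of k] bneg[of l] by (metis less_asym)
    have alt: "alternating_cycle (intersection_graph \<sigma> \<tau>) (zigzag a b m)"
      using am ainj binj ab pAB[OF pe] qAB[OF qe]
      by (intro alternating_cycle_zigzag) (auto simp: steps_intersection_graph, metis)
    define P where "P = (\<lambda>k. (a k, b k)) ` {..<m}"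
    define Q where "Q = (\<lambda>k. (a (Suc k), b k)) ` {..<m}"
    \<comment> \<open>The minimum over the edges of both flows on the cycle: neither flow becomes
      negative, and at least one entry drops to zero.\<close>
    define \<epsilon> where "\<epsilon> = Min (p ` P \<union> q ` Q)"
    have fin: "finite (p ` P \<union> q ` Q)" "p ` P \<union> q ` Q \<noteq> {}" using m by (auto simp: P_def Q_def)
    have "\<epsilon> \<in> p ` P \<union> q ` Q" unfolding \<epsilon>_def using fin by (rule Min_in)
    moreover have "0 < v" if "v \<in> p ` P \<union> q ` Q" for v using that pe qe by (auto simp: P_def Q_def)
    ultimately have \<epsilon>: "0 < \<epsilon>" "\<epsilon> \<in> p ` P \<union> q ` Q" by auto
    have \<epsilon>p: "\<epsilon> \<le> p e" if "e \<in> P" for e unfolding \<epsilon>_def using fin that by (intro Min_le) auto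
    have \<epsilon>q: "\<epsilon> \<le> q e" if "e \<in> Q" for e unfolding \<epsilon>_def using fin that by (intro Min_le) auto
    define p' where "p' = (\<lambda>e. p e - (if e \<in> P then \<epsilon> else 0))"
    define q' where "q' = (\<lambda>e. q e - (if e \<in> Q then \<epsilon> else 0))"
    define x' where "x' = x - \<epsilon> *\<^sub>R cycle_vec (zigzag a b m)"
    have "(\<Sum>e\<in>P. root_vec (fst e) (snd e)) = cycle_vec (zigzag a b m)"
      unfolding P_def cycle_vec_zigzag using ainj by (subst sum.reindex) (auto simp: inj_on_def)
    then have p'x: "flow_vec p' = x'"
      unfolding p'_def x'_def flow_vec_subtract_set using p(2) by simp
    \<comment> \<open>Rotating the tails does not change their sum, so \<open>P\<close> and
      \<open>Q\<close> carry the same vector and both flows still represent a common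
      \<open>x'\<close>.\<close>
    have "(\<Sum>e\<in>Q. root_vec (fst e) (snd e)) = (\<Sum>k<m. root_vec (a (Suc k)) (b k))"
      unfolding Q_def using binj by (subst sum.reindex) (auto simp: inj_on_def)
    also have "\<dots> = cycle_vec (zigzag a b m)"
      unfolding cycle_vec_zigzag root_vec_def sum_subtractf
      using sum.lessThan_Suc_shift[of "\<lambda>k. axis (a k) 1 :: real ^ 'n" m] am by simp
    finally have q'x: "flow_vec q' = x'"
      unfolding q'_def x'_def flow_vec_subtract_set using q(2) by simp
    have p'le: "p' e \<le> p e" and q'le: "q' e \<le> q e" for e using \<epsilon> by (auto simp: p'_def q'_def)
    have p'on: "flow_on ({(i, j). root_vec i j \<in> \<sigma>} \<inter> A \<times> B) p'"
      unfolding flow_on_def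
    proof (intro conjI allI impI)
      show "0 \<le> p' e" for e using \<epsilon>p pn by (simp add: p'_def)
      show "e \<in> {(i, j). root_vec i j \<in> \<sigma>} \<inter> A \<times> B" if "0 < p' e" for e
        using flow_onD(2)[OF p(1) less_le_trans[OF that p'le]] .
    qed
    have q'on: "flow_on ({(i, j). root_vec i j \<in> \<tau>} \<inter> A \<times> B) q'"
      unfolding flow_on_def
    proof (intro conjI allI impI)
      show "0 \<le> q' e" for e using \<epsilon>q qn by (simp add: q'_def)
      show "e \<in> {(i, j). root_vec i j \<in> \<tau>} \<inter> A \<times> B" if "0 < q' e" for e
        using flow_onD(2)[OF q(1) less_le_trans[OF that q'le]] .
    qed
    have sub: "{e. 0 < p' e} \<subseteq> {e. 0 < p e}" "{e. 0 < q' e} \<subseteq> {e. 0 < q e}"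
      using p'le q'le by (auto intro: less_le_trans)
    then have le: "card {e. 0 < p' e} \<le> card {e. 0 < p e}" "card {e. 0 < q' e} \<le> card {e. 0 < q e}"
      by (auto intro: card_mono)
    have "card {e. 0 < p' e} + card {e. 0 < q' e} < card {e. 0 < p e} + card {e. 0 < q e}"
      using \<epsilon>(2)
    proof
      assume "\<epsilon> \<in> p ` P"
      then obtain e where "e \<in> P" "p e = \<epsilon>" by auto
      then have "e \<in> {e. 0 < p e} - {e. 0 < p' e}" using \<epsilon> by (simp add: p'_def)
      then have "card {e. 0 < p' e} < card {e. 0 < p e}"
        using sub(1) by (intro psubset_card_mono) auto
      then show ?thesis using le(2) by simp
    next
      assume "\<epsilon> \<in> q ` Q"
      then obtain e where "e \<in> Q" "q e = \<epsilon>" by auto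
      then have "e \<in> {e. 0 < q e} - {e. 0 < q' e}" using \<epsilon> by (simp add: q'_def)
      then have "card {e. 0 < q' e} < card {e. 0 < q e}"
        using sub(2) by (intro psubset_card_mono) auto
      then show ?thesis using le(1) by simp
    qed
    then have "x' \<in> nonneg_span R"
      using less.hyps p'on p'x q'on q'x by blast
    moreover have "\<epsilon> *\<^sub>R cycle_vec (zigzag a b m) \<in> nonneg_span R"
      using assms(1)[OF alt] \<epsilon>(1) by (simp add: nonneg_span_scale)
    ultimately have "x' + \<epsilon> *\<^sub>R cycle_vec (zigzag a b m) \<in> nonneg_span R"
      by (rule nonneg_span_add)
    then show ?thesis by (simp add: x'_def)
  qed
qed

text \<open>One of two consecutive steps is upper. This makes the number of upper steps drop
  strictly when a cycle is split.\<close>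

lemma upper_tails_nonempty:
  assumes C: "alternating_cycle G C" and "C \<noteq> []"
  shows "upper_tails C \<noteq> {#}"
proof -
  let ?k = "Suc 0 mod length C"
  have n: "0 < length C" using assms by simp
  then have "C ! 0 \<in> set C" "C ! ?k \<in> set C" by (intro nth_mem mod_less_divisor; simp)+
  moreover have "step_layer (C ! 0) \<noteq> step_layer (C ! ?k)"
    using C n by (auto simp: alternating_cycle_def)
  then have "step_layer (C ! 0) = Upper \<or> step_layer (C ! ?k) = Upper"
    by (metis layer.exhaust)
  ultimately have "filter (\<lambda>s. step_layer s = Upper) C \<noteq> []"
    by (auto simp: filter_empty_conv)
  then show ?thesis by (simp add: upper_tails_def del: mset_filter)
qed

lemma cycle_vec_sum_list:
  assumes "upper_heads C = sum_list (map upper_heads Cs)"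
    and "upper_tails C = sum_list (map upper_tails Cs)"
  shows "cycle_vec C = sum_list (map cycle_vec Cs)"
proof -
  have "(\<Sum>i\<in>#sum_list (map upper_tails Cs). axis i 1) - (\<Sum>j\<in>#sum_list (map upper_heads Cs). axis j 1)
      = sum_list (map cycle_vec Cs)"
    by (induction Cs) (auto simp: cycle_vec_def)
  then show ?thesis using assms by (simp add: cycle_vec_def)
qed

text \<open>Induction on the number of upper steps. A cycle of length at least four is not primitive
  and splits into cycles with fewer upper steps. Alternation excludes lengths one and three, and a
  cycle of length two is a common root.\<close>

lemma cycle_vec_in_span_common_roots:
  fixes \<sigma> \<tau> :: "(real ^ 'n::finite) set"
  assumes noprim: "\<not> (\<exists>C. primitive (intersection_graph \<sigma> \<tau>) C \<and> length C \<ge> 4)"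
    and "alternating_cycle (intersection_graph \<sigma> \<tau>) C"
  shows "cycle_vec C \<in> nonneg_span (roots \<inter> \<sigma> \<inter> \<tau>)"
  using assms(2)
proof (induction "size (upper_tails C)" arbitrary: C rule: less_induct)
  case less
  let ?G = "intersection_graph \<sigma> \<tau>"
  note C = less.prems
  have st: "s \<in> steps ?G" if "s \<in> set C" for s
    using C that by (auto simp: alternating_cycle_def cycle_def closed_walk_def)
  have nxt: "step_head (C ! k) = step_tail (C ! (Suc k mod length C))"
      "step_layer (C ! k) \<noteq> step_layer (C ! (Suc k mod length C))" if "k < length C" for k
    using C that by (auto simp: alternating_cycle_def cycle_def closed_walk_def)
  have pair: "root_vec i j \<in> nonneg_span (roots \<inter> \<sigma> \<inter> \<tau>)"
    if "(Upper, i, j) \<in> steps ?G" "(Lower, j, i) \<in> steps ?G" for i j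
    using that finite_roots unfolding steps_intersection_graph
    by (intro nonneg_span_base) (auto simp: roots_def)
  consider "C = []" | s where "C = [s]" | s t where "C = [s, t]" | s t u where "C = [s, t, u]" | "length C \<ge> 4"
  proof (cases C)
    case (Cons s D)
    note 1 = this
    show thesis
    proof (cases D)
      case (Cons t E)
      note 2 = this
      show thesis
      proof (cases E)
        case (Cons u F)
        then show thesis using 1 2 that by (cases F) auto
      qed (use 1 2 that in auto)
    qed (use 1 that in auto)
  qed (use that in auto)
  then show ?case
  proof cases
    case 1
    then show ?thesis by (simp add: cycle_vec_upper nonneg_span_zero)
  next
    case 2
    then show ?thesis using nxt[of 0] by simp
  next
    case (3 s t)
    obtain l i j where s: "s = (l, i, j)" by (cases s)
    obtain l' i' j' where t: "t = (l', i', j')" by (cases t)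
    have e: "j = i'" "i = j'" "l \<noteq> l'" 
      using nxt[of 0] nxt[of 1] 3 s t by (auto simp: step_head_def step_tail_def step_layer_def)
    show ?thesis
    proof (cases l)
      case Upper
      then have "l' = Lower" using e by (cases l') auto
      then show ?thesis using Upper e s t 3 pair[of i j] st[of s] st[of t]
        by (simp add: cycle_vec_upper step_head_def step_tail_def step_layer_def)
    next
      case Lower
      then have "l' = Upper" using e by (cases l') auto
      then show ?thesis using Lower e s t 3 pair[of j i] st[of s] st[of t]
        by (simp add: cycle_vec_upper step_head_def step_tail_def step_layer_def)
    qed
  next
    case (4 s t u)
    then have "step_layer s \<noteq> step_layer t" "step_layer t \<noteq> step_layer u" "step_layer u \<noteq> step_layer s"
      using nxt(2)[of 0] nxt(2)[of 1] nxt(2)[of 2] by auto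
    then show ?thesis by (metis layer.exhaust)
  next
    case 5
    then have "\<not> primitive ?G C" using noprim by auto
    then obtain Cs where Cs: "2 \<le> length Cs" "\<forall>D\<in>set Cs. D \<noteq> [] \<and> alternating_cycle ?G D"
      "upper_heads C = sum_list (map upper_heads Cs)" "upper_tails C = sum_list (map upper_tails Cs)"
      using C by (auto simp: primitive_def)
    have "cycle_vec D \<in> nonneg_span (roots \<inter> \<sigma> \<inter> \<tau>)" if D: "D \<in> set Cs" for D
    proof (rule less.hyps)
      show "alternating_cycle ?G D" using Cs(2) D by auto
      obtain ys zs where ys: "Cs = ys @ D # zs" using D by (auto dest: split_list)
      then have "ys @ zs \<noteq> []" using Cs(1) by auto
      \<comment> \<open>Another cycle \<open>E\<close> of the splitting takes at least one upper
        tail, so \<open>D\<close> has strictly fewer than \<open>C\<close>.\<close>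
      then obtain E where E: "E \<in> set (ys @ zs)" by (meson last_in_set)
      then have "upper_tails E \<noteq> {#}" using Cs(2) ys by (intro upper_tails_nonempty) auto
      moreover have "upper_tails C = upper_tails D + sum_list (map upper_tails (ys @ zs))"
        unfolding Cs(4) ys by (simp add: ac_simps)
      moreover obtain us vs where "ys @ zs = us @ E # vs" using E by (meson split_list)
      then have "sum_list (map upper_tails (ys @ zs)) =
          upper_tails E + sum_list (map upper_tails (us @ vs))"
        by (simp add: ac_simps del: map_append) (simp add: ac_simps)
      ultimately show "size (upper_tails D) < size (upper_tails C)"
        by (simp add: nonempty_has_size)
    qed
    then show ?thesis
      unfolding cycle_vec_sum_list[OF Cs(3,4)] by (intro nonneg_span_sum_list) auto
  qed
qed

section \<open>Splitting a cycle\<close>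

text \<open>Heads are tails of successors, so they are distinct like the tails. An upper tail equal
  to an upper head would put two upper steps in succession.\<close>

lemma alternating_cycle_upper:
  assumes C: "alternating_cycle G C"
  defines "U \<equiv> filter (\<lambda>s. step_layer s = Upper) C"
  shows "distinct (map step_tail U)" "distinct (map step_head U)"
    "step_tail ` set U \<inter> step_head ` set U = {}"
proof -
  let ?n = "length C"
  have dist: "distinct (map step_tail C)"
    and nxt: "\<And>k. k < ?n \<Longrightarrow> step_head (C ! k) = step_tail (C ! (Suc k mod ?n))"
      "\<And>k. k < ?n \<Longrightarrow> step_layer (C ! k) \<noteq> step_layer (C ! (Suc k mod ?n))"
    using C by (auto simp: alternating_cycle_def cycle_def closed_walk_def)
  have tinj: "k = l" if "step_tail (C ! k) = step_tail (C ! l)" "k < ?n" "l < ?n" for k l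
    using dist that by (auto simp: distinct_conv_nth)
  have lt: "Suc k mod ?n < ?n" if "k < ?n" for k using that by (intro mod_less_divisor) auto
  have hinj: "k = l" if "step_head (C ! k) = step_head (C ! l)" "k < ?n" "l < ?n" for k l
  proof -
    have "Suc k mod ?n = Suc l mod ?n" using that nxt lt tinj by metis
    then show ?thesis using inj_on_Suc_mod[of ?n] that by (auto simp: inj_on_def)
  qed
  then have "distinct (map step_head C)" by (auto simp: distinct_conv_nth)
  then show "distinct (map step_head U)" unfolding U_def by (rule distinct_map_filter)
  show "distinct (map step_tail U)" unfolding U_def using dist by (rule distinct_map_filter)
  show "step_tail ` set U \<inter> step_head ` set U = {}"
  proof (rule ccontr)
    assume "\<not> ?thesis"
    then obtain s t where "s \<in> set U" "t \<in> set U" "step_tail s = step_head t" by auto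
    then obtain k l where "k < ?n" "l < ?n" "step_layer (C ! k) = Upper" "step_layer (C ! l) = Upper"
      "step_tail (C ! k) = step_head (C ! l)"
      unfolding U_def by (auto simp: in_set_conv_nth)
    then show False using nxt lt tinj by metis
  qed
qed

text \<open>One of the steps 0 and 1 is upper, and so is one of the steps 2 and 3.\<close>

lemma two_le_size_upper_tails:
  assumes C: "alternating_cycle G C" and len: "4 \<le> length C"
  shows "2 \<le> size (upper_tails C)"
proof -
  have alt: "step_layer (C ! k) \<noteq> step_layer (C ! Suc k)" if "Suc k < length C" for k
    using C that unfolding alternating_cycle_def by (metis Suc_lessD mod_less)
  obtain k where k: "k \<in> {0, 1}" "step_layer (C ! k) = Upper"
    using alt[of 0] len by (cases "step_layer (C ! 0)"; cases "step_layer (C ! 1)") auto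
  obtain l where l: "l \<in> {2, 3}" "step_layer (C ! l) = Upper"
    using alt[of 2] len by (cases "step_layer (C ! 2)"; cases "step_layer (C ! 3)") (auto simp: eval_nat_numeral)
  have "card {k, l} \<le> card {i. i < length C \<and> step_layer (C ! i) = Upper}"
    using k l len by (intro card_mono) auto
  moreover have "card {k, l} = 2" using k l by auto
  ultimately show ?thesis by (simp add: upper_tails_def length_filter_conv_card del: mset_filter)
qed

text \<open>The flow is a doubly stochastic matrix. The mass leaving \<open>J\<close> is
  \<open>card J\<close> and ends in the neighbours of \<open>J\<close>, each of which receives only
  1; this is Hall's condition.\<close>

lemma matching_in_flow:
  fixes p :: "'n::finite \<times> 'n \<Rightarrow> real"
  assumes p: "flow_on E p" and E: "E \<subseteq> A \<times> B" and "A \<inter> B = {}" and "card A = card B"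
    and xA: "\<And>i. i \<in> A \<Longrightarrow> flow_vec p $ i = 1" and xB: "\<And>j. j \<in> B \<Longrightarrow> flow_vec p $ j = - 1"
  obtains f where "bij_betw f A B" "\<And>i. i \<in> A \<Longrightarrow> (i, f i) \<in> E"
proof -
  have nn: "0 \<le> p e" for e using p by (rule flow_onD)
  have pz: "p (i, j) = 0" if "(i, j) \<notin> E" for i j
    using that nn[of "(i, j)"] flow_onD(2)[OF p, of "(i, j)"] by (auto simp: less_le)
  have row: "(\<Sum>j\<in>UNIV. p (i, j)) = 1" if "i \<in> A" for i
  proof -
    have "p (k, i) = 0" for k using that E assms(3) by (intro pz) auto
    then show ?thesis using xA[OF that] by (simp add: flow_vec_nth)
  qed
  have col: "(\<Sum>i\<in>UNIV. p (i, j)) = 1" if "j \<in> B" for j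
  proof -
    have "p (j, k) = 0" for k using that E assms(3) by (intro pz) auto
    then show ?thesis using xB[OF that] by (simp add: flow_vec_nth)
  qed
  define F where "F i = {j. (i, j) \<in> E}" for i
  have "\<exists>f. inj_on f A \<and> (\<forall>i\<in>A. f i \<in> F i)"
  proof (rule Hall_marriage)
    fix J assume J: "J \<subseteq> A"
    let ?N = "\<Union>(F ` J)"
    have N: "?N \<subseteq> B" using E by (auto simp: F_def)
    have "real (card J) = (\<Sum>i\<in>J. \<Sum>j\<in>UNIV. p (i, j))" using row J by (simp add: subset_eq)
    also have "\<dots> = (\<Sum>i\<in>J. \<Sum>j\<in>?N. p (i, j))"
      by (intro sum.cong refl sum.mono_neutral_right) (auto simp: F_def intro: pz)
    also have "\<dots> = (\<Sum>j\<in>?N. \<Sum>i\<in>J. p (i, j))" by (rule sum.swap)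
    also have "\<dots> \<le> (\<Sum>j\<in>?N. \<Sum>i\<in>UNIV. p (i, j))"
      by (intro sum_mono sum_mono2) (auto simp: nn)
    also have "\<dots> = real (card ?N)" using sum.cong[OF refl col[OF subsetD[OF N]], of ?N "\<lambda>j. j"] by simp
    finally show "card J \<le> card ?N" by simp
  qed auto
  then obtain f where f: "inj_on f A" "\<forall>i\<in>A. (i, f i) \<in> E" by (auto simp: F_def)
  then have "f ` A \<subseteq> B" using E by auto
  then have "f ` A = B" using f(1) assms(4) by (intro card_subset_eq) (auto simp: card_image)
  then show thesis using that f by (auto simp: bij_betw_def)
qed

text \<open>The vector of \<open>C\<close> is 1 on upper tails and -1 on upper heads. A bipartite
  flow for it in the intersection yields a perfect matching of tails with heads by common roots, and
  the matched pairs split \<open>C\<close>.\<close>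

lemma not_primitive_if_root_cone:
  fixes \<sigma> \<tau> :: "(real ^ 'n::finite) set"
  assumes "root_cone \<sigma>" "root_cone \<tau>" "root_cone (\<sigma> \<inter> \<tau>)"
    and C: "alternating_cycle (intersection_graph \<sigma> \<tau>) C" and len: "4 \<le> length C"
  shows "\<not> primitive (intersection_graph \<sigma> \<tau>) C"
proof -
  let ?G = "intersection_graph \<sigma> \<tau>"
  define U where "U = filter (\<lambda>s. step_layer s = Upper) C"
  define as where "as = map step_tail U"
  define bs where "bs = map step_head U"
  have d: "distinct as" "distinct bs" "set as \<inter> set bs = {}"
    using alternating_cycle_upper[OF C] by (auto simp: as_def bs_def U_def)
  have ut: "upper_tails C = mset as" and uh: "upper_heads C = mset bs"
    by (simp_all add: upper_tails_def upper_heads_def as_def bs_def U_def)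
  define x where "x = cycle_vec C"
  have "x = (\<Sum>i\<in>set as. axis i 1) - (\<Sum>j\<in>set bs. axis j 1)"
    unfolding x_def cycle_vec_def ut uh using d
    by (simp add: sum_unfold_sum_mset mset_set_set)
  then have xn: "x $ v = (if v \<in> set as then 1 else 0) - (if v \<in> set bs then 1 else 0)" for v
    by (simp add: axis_def if_distrib cong: if_cong)
  have "x \<in> \<sigma> \<inter> \<tau>"
    unfolding x_def using assms by (intro cycle_vec_in_cones) (auto simp: alternating_cycle_def cycle_def)
  then obtain p where p: "flow_on ({(i, j). root_vec i j \<in> \<sigma> \<inter> \<tau>} \<inter> {i. 0 < x $ i} \<times> {j. x $ j < 0}) p"
    "flow_vec p = x"
    using root_cone_bipartite_flow[OF assms(3)] by blast
  have sets: "{i. 0 < x $ i} = set as" "{j. x $ j < 0} = set bs" using d(3) by (auto simp: xn)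
  have "card (set as) = card (set bs)" using d by (simp add: distinct_card) (simp add: as_def bs_def)
  then obtain f where f: "bij_betw f (set as) (set bs)"
    "\<And>i. i \<in> set as \<Longrightarrow> (i, f i) \<in> {(i, j). root_vec i j \<in> \<sigma> \<inter> \<tau>} \<inter> set as \<times> set bs"
    using matching_in_flow[OF p(1)[unfolded sets] Int_lower2 d(3)] p(2) xn d(3)
    by (smt (verit) disjoint_iff)
  \<comment> \<open>The cycle of length two going up from \<open>i\<close> to \<open>f i\<close> and
    down again along the same common root.\<close>
  define D where "D i = zigzag (\<lambda>_. i) (\<lambda>_. f i) 1" for i
  have D: "D i \<noteq> [] \<and> alternating_cycle ?G (D i)" if "i \<in> set as" for i
  proof
    show "D i \<noteq> []" by (simp add: D_def zigzag_def)
    have "i \<noteq> f i" using f(2)[OF that] d(3) by auto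
    then show "alternating_cycle ?G (D i)"
      unfolding D_def using f(2)[OF that]
      by (intro alternating_cycle_zigzag) (auto simp: steps_intersection_graph inj_on_def)
  qed
  have uD: "upper_tails (D i) = {#i#}" "upper_heads (D i) = {#f i#}" for i
    by (simp_all add: D_def upper_zigzag)
  have sl: "sum_list (map (\<lambda>i. {#g i#}) xs) = mset (map g xs)" for g :: "'n \<Rightarrow> 'n" and xs
    by (induction xs) auto
  \<comment> \<open>The matching may pair tails and heads differently from \<open>C\<close>, so the
    heads agree only as multisets.\<close>
  have "mset (map f as) = image_mset f (mset_set (set as))" using d(1) by (simp add: mset_set_set)
  also have "\<dots> = mset_set (set bs)" using f(1) by (auto simp: bij_betw_def image_mset_mset_set)
  also have "\<dots> = mset bs" using d(2) by (rule mset_set_set)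
  finally have "upper_heads C = sum_list (map upper_heads (map D as))"
    by (simp add: uh comp_def uD sl)
  moreover have "upper_tails C = sum_list (map upper_tails (map D as))"
    using sl[of "\<lambda>i. i"] by (simp add: ut comp_def uD)
  moreover have "2 \<le> length (map D as)" using two_le_size_upper_tails[OF C len] ut by simp
  moreover have "\<forall>E\<in>set (map D as). E \<noteq> [] \<and> alternating_cycle ?G E" using D by simp
  ultimately show ?thesis unfolding primitive_def by blast
qed

theorem theorem3p10:
  fixes \<sigma> \<tau> :: "(real ^ 'n::finite) set"
  assumes "root_cone \<sigma>" and "root_cone \<tau>"
  shows "root_cone (\<sigma> \<inter> \<tau>) \<longleftrightarrow>
    \<not> (\<exists>C. primitive (intersection_graph \<sigma> \<tau>) C \<and> length C \<ge> 4)"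
proof
  assume "root_cone (\<sigma> \<inter> \<tau>)"
  then show "\<not> (\<exists>C. primitive (intersection_graph \<sigma> \<tau>) C \<and> length C \<ge> 4)"
    using not_primitive_if_root_cone[OF assms] by (auto simp: primitive_def)
next
  assume noprim: "\<not> (\<exists>C. primitive (intersection_graph \<sigma> \<tau>) C \<and> length C \<ge> 4)"
  let ?R = "roots \<inter> \<sigma> \<inter> \<tau>"
  have "x \<in> nonneg_span ?R" if x: "x \<in> \<sigma>" "x \<in> \<tau>" for x
  proof -
    obtain p where p: "flow_on ({(i, j). root_vec i j \<in> \<sigma>} \<inter> {i. 0 < x $ i} \<times> {j. x $ j < 0}) p"
      "flow_vec p = x" by (rule root_cone_bipartite_flow[OF assms(1) x(1)])
    obtain q where q: "flow_on ({(i, j). root_vec i j \<in> \<tau>} \<inter> {i. 0 < x $ i} \<times> {j. x $ j < 0}) q"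
      "flow_vec q = x" by (rule root_cone_bipartite_flow[OF assms(2) x(2)])
    show ?thesis
      by (rule flow_vec_in_span_of_cycles[OF cycle_vec_in_span_common_roots[OF noprim] _ p q]) auto
  qed
  \<comment> \<open>The easy inclusion, needed for both \<sigma> and \<tau> in place of \<rho>: a
    root cone contains every nonnegative combination of its elements.\<close>
  moreover have "nonneg_span ?R \<subseteq> \<rho>" if "root_cone \<rho>" "?R \<subseteq> \<rho>" for \<rho>
  proof
    fix x assume "x \<in> nonneg_span ?R"
    then obtain c where c: "x = (\<Sum>r\<in>?R. c r *\<^sub>R r)" "\<forall>r\<in>?R. 0 \<le> c r"
      by (auto simp: nonneg_span_def)
    obtain S where "\<rho> = nonneg_span S" using \<open>root_cone \<rho>\<close> by (auto simp: root_cone_def)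
    then show "x \<in> \<rho>"
      unfolding c(1) using c(2) that(2) by (auto intro!: nonneg_span_sum nonneg_span_scale)
  qed
  ultimately have "\<sigma> \<inter> \<tau> = nonneg_span ?R" using assms by blast
  then show "root_cone (\<sigma> \<inter> \<tau>)"
    unfolding root_cone_def using finite_roots by (intro exI[of _ ?R]) auto
qed

end
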